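(* Let $D$ be a finite $3$-semi-symmetric digraph. If no two distinct lonely arcs of $D$ have a common endvertex, then $D$ is BE-diperfect.
   Context: Digraphs have no loops and no parallel arcs, but may contain both arcs $uv$ and $vu$ (cycles of length two). Two vertices $u,v$ are adjacent if $uv$ or $vu$ is an arc. An arc $uv$ of $D$ is lonely if $vu\notin A(D)$. A digraph is $k$-semi-symmetric if it has at most $k$ lonely arcs. A stable set is a set of pairwise non-adjacent vertices; it is maximum if no stable set has larger cardinality. A path of $D$ is a directed path, i.e. a sequence $v_1v_2\cdots v_\ell$ of distinct vertices ($\ell\ge 1$) with $v_iv_{i+1}\in A(D)$ for $1\le i<\ell$. A path partition of $D$ is a collection of paths whose vertex sets partition $V(D)$. For a stable set $S$, an $S_{\rm BE}$-path partition of $D$ is a path partition $\mathcal P$ such that every $P=x_1x_2\cdots x_k\in\mathcal P$ satisfies $V(P)\cap S=\{x\}$ with $x\in\{x_1,x_k\}$. A digraph satisfies the BE-property if it has an $S_{\rm BE}$-path partition for every maximum stable set $S$. A digraph is BE-diperfect if every induced subdigraph of it satisfies the BE-property. *)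

theory Defs
  imports
    "HOL-Library.Disjoint_Sets"
    "Graph_Theory.Digraph_Component"
    "Graph_Theory.Vertex_Walk"
begin

text \<open>
  The locale \<^locale>\<open>digraph\<close> requires finitely many vertices and arcs, no loops and no
  parallel arcs; opposite arcs are allowed. Cardinalities of vertex sets below are meant
  for such digraphs.
\<close>

definition adjacent :: "('a,'b) pre_digraph \<Rightarrow> 'a \<Rightarrow> 'a \<Rightarrow> bool" where
  "adjacent D u v \<longleftrightarrow> (u, v) \<in> arcs_ends D \<or> (v, u) \<in> arcs_ends D"

definition lonely_arcs :: "('a,'b) pre_digraph \<Rightarrow> 'b set" where
  "lonely_arcs D = {e \<in> arcs D. (head D e, tail D e) \<notin> arcs_ends D}"

definition semi_symmetric :: "nat \<Rightarrow> ('a,'b) pre_digraph \<Rightarrow> bool" where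
  "semi_symmetric k D \<longleftrightarrow> finite (lonely_arcs D) \<and> card (lonely_arcs D) \<le> k"

definition arc_endvertices :: "('a,'b) pre_digraph \<Rightarrow> 'b \<Rightarrow> 'a set" where
  "arc_endvertices D e = {tail D e, head D e}"

definition stable_set :: "('a,'b) pre_digraph \<Rightarrow> 'a set \<Rightarrow> bool" where
  "stable_set D S \<longleftrightarrow> S \<subseteq> verts D \<and> pairwise (\<lambda>u v. \<not> adjacent D u v) S"

definition maximum_stable_set :: "('a,'b) pre_digraph \<Rightarrow> 'a set \<Rightarrow> bool" where
  "maximum_stable_set D S \<longleftrightarrow>
     stable_set D S \<and> (\<forall>T. stable_set D T \<longrightarrow> card T \<le> card S)"

text \<open>
  Paths are the vertex sequences of \<^const>\<open>vpath\<close>, which are nonempty and distinct.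
  Disjointness as an indexed family also rules out two different paths on the same
  vertex set.
\<close>

definition path_partition :: "('a,'b) pre_digraph \<Rightarrow> 'a list set \<Rightarrow> bool" where
  "path_partition D P \<longleftrightarrow>
     (\<forall>p\<in>P. vpath p D) \<and> disjoint_family_on set P \<and> (\<Union>p\<in>P. set p) = verts D"

definition BE_path_partition :: "('a,'b) pre_digraph \<Rightarrow> 'a set \<Rightarrow> 'a list set \<Rightarrow> bool" where
  "BE_path_partition D S P \<longleftrightarrow>
     path_partition D P \<and> (\<forall>p\<in>P. \<exists>x\<in>{hd p, last p}. set p \<inter> S = {x})"

definition BE_property :: "('a,'b) pre_digraph \<Rightarrow> bool" where
  "BE_property D \<longleftrightarrow> (\<forall>S. maximum_stable_set D S \<longrightarrow> (\<exists>P. BE_path_partition D S P))"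

definition BE_diperfect :: "('a,'b) pre_digraph \<Rightarrow> bool" where
  "BE_diperfect D \<longleftrightarrow> (\<forall>H. induced_subgraph H D \<longrightarrow> BE_property H)"

end

theory Submission
  imports Defs
begin

text \<open>
  The lonely arcs of an induced subdigraph are lonely in the whole digraph, so it suffices to
  find a begin-end partition of a digraph with vertex set \<open>V\<close> and arc relation \<open>E\<close>, for a
  maximum stable set \<open>S\<close>. If no lonely arc enters \<open>S\<close>, the arcs into \<open>S\<close> can be deleted without
  creating larger stable sets; the vertices of \<open>S\<close> are then sources, and the Gallai--Milgram
  theorem yields \<open>card S\<close> paths, each of which must begin at a different vertex of \<open>S\<close>
  (\<open>rooted_partition_exists\<close>). If no lonely arc leaves \<open>S\<close>, reverse all arcs. If no lonely arc
  avoids \<open>S\<close>, apply the same result to the symmetric closure: a path then uses at most one lonely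
  arc, its first one, so the path or its reversal is a path of the digraph. With at most three
  lonely arcs, what remains is one lonely arc \<open>a \<rightarrow> a'\<close> leaving \<open>S\<close>, one \<open>b' \<rightarrow> b\<close> entering \<open>S\<close>
  and one \<open>c \<rightarrow> d\<close> outside \<open>S\<close>, with six different endvertices
  (\<open>begin_end_three_lonely\<close>).

  In that case, suppose first that every stable set avoiding \<open>b\<close> and \<open>b'\<close> is smaller than \<open>S\<close>.
  Then \<open>S - {b}\<close> is maximum in \<open>V - {b, b'}\<close> and no lonely arc enters it there, so the
  path \<open>b' b\<close> completes a partition of \<open>V - {b, b'}\<close>. Otherwise there is a maximum stable set \<open>U\<close>
  that avoids both \<open>b\<close> and \<open>b'\<close>. A perfect matching links \<open>S - U\<close> to \<open>U - S\<close>
  (\<open>max_indep_matching\<close>), and prepending it to a partition of \<open>V - (S - U)\<close> into paths beginning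
  in \<open>U\<close> gives a partition into paths beginning in \<open>S\<close> (\<open>rooted_partition_link\<close>). The gain is
  that \<open>b\<close> is matched to a vertex different from \<open>b'\<close>, so the arc from \<open>b\<close> to \<open>b'\<close>, which does
  not exist, is never needed. The arc \<open>c \<rightarrow> d\<close> is harmful only if \<open>d \<in> U\<close>; it is then replaced
  by \<open>d \<rightarrow> c\<close>. The reversed arc can occur only on the path through \<open>d\<close>. That path begins with the
  partner \<open>s\<close> of \<open>d\<close> in the matching, followed by \<open>d\<close>, so it contains neither \<open>a \<rightarrow> a'\<close> nor
  \<open>b' \<rightarrow> b\<close> as an arc, and its reversal is a path of the digraph.
\<close>

section \<open>Path partitions of a relation\<close>

definition dipath :: "('a \<times> 'a) set \<Rightarrow> 'a list \<Rightarrow> bool" where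
  "dipath E p \<longleftrightarrow> p \<noteq> [] \<and> distinct p \<and> successively (\<lambda>x y. (x, y) \<in> E) p"

definition dipath_partition :: "'a set \<Rightarrow> ('a \<times> 'a) set \<Rightarrow> 'a list set \<Rightarrow> bool" where
  "dipath_partition V E P \<longleftrightarrow>
     (\<forall>p\<in>P. dipath E p) \<and> disjoint_family_on set P \<and> (\<Union>p\<in>P. set p) = V"

definition indep :: "('a \<times> 'a) set \<Rightarrow> 'a set \<Rightarrow> bool" where
  "indep E T \<longleftrightarrow> pairwise (\<lambda>x y. (x, y) \<notin> E) T"

definition max_indep :: "'a set \<Rightarrow> ('a \<times> 'a) set \<Rightarrow> 'a set \<Rightarrow> bool" where
  "max_indep V E S \<longleftrightarrow>
     S \<subseteq> V \<and> indep E S \<and> (\<forall>T. T \<subseteq> V \<longrightarrow> indep E T \<longrightarrow> card T \<le> card S)"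

text \<open>
  The form in which begin-end partitions are constructed: all paths begin in \<open>S\<close>. The relation
  \<open>E\<close> may differ from the arc relation of the digraph; individual paths are reversed later.
\<close>

definition rooted_partition ::
    "'a set \<Rightarrow> ('a \<times> 'a) set \<Rightarrow> 'a set \<Rightarrow> 'a list set \<Rightarrow> bool" where
  "rooted_partition V E S P \<longleftrightarrow>
     dipath_partition V E P \<and> (\<forall>p\<in>P. set p \<inter> S = {hd p})"

lemma indepD: "indep E T \<Longrightarrow> x \<in> T \<Longrightarrow> y \<in> T \<Longrightarrow> x \<noteq> y \<Longrightarrow> (x, y) \<notin> E"
  by (auto simp: indep_def pairwise_def)

lemma indepI: "(\<And>x y. x \<in> T \<Longrightarrow> y \<in> T \<Longrightarrow> x \<noteq> y \<Longrightarrow> (x, y) \<notin> E) \<Longrightarrow> indep E T"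
  by (auto simp: indep_def pairwise_def)

lemma indep_subset: "indep E T \<Longrightarrow> T' \<subseteq> T \<Longrightarrow> indep E T'"
  by (auto simp: indep_def pairwise_def)

text \<open>
  Stability depends only on the underlying graph; this is what permits reversing arcs, adding
  opposite arcs and deleting one of two opposite arcs.
\<close>

lemma max_indep_cong:
  assumes "max_indep V E S" "\<And>x y. (x, y) \<in> F \<or> (y, x) \<in> F \<longleftrightarrow> (x, y) \<in> E \<or> (y, x) \<in> E"
  shows "max_indep V F S"
proof -
  have "indep F T \<longleftrightarrow> indep E T" for T
    using assms(2) unfolding indep_def pairwise_def by metis
  then show ?thesis using assms(1) by (simp add: max_indep_def)
qed

lemma dipath_Cons:
  "dipath E (x # p) \<longleftrightarrow> x \<notin> set p \<and> (p = [] \<or> (x, hd p) \<in> E \<and> dipath E p)"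
  by (auto simp: dipath_def successively_Cons)

lemma dipath_mono:
  assumes "dipath E p" "\<And>x y. x \<in> set p \<Longrightarrow> y \<in> set p \<Longrightarrow> (x, y) \<in> E \<Longrightarrow> (x, y) \<in> F"
  shows "dipath F p"
  using assms(1) successively_mono[of "\<lambda>x y. (x, y) \<in> E" p "\<lambda>x y. (x, y) \<in> F"] assms(2)
  unfolding dipath_def by blast

lemma dipath_rev: "dipath E (rev p) \<longleftrightarrow> dipath (E\<inverse>) p"
  by (auto simp: dipath_def)

lemma dipath_into_head:
  assumes "dipath E p" "v \<in> set p" "v \<noteq> hd p"
  shows "\<exists>u \<in> set p. (u, v) \<in> E"
  using assms
proof (induction p)
  case (Cons x p)
  then have p: "v \<in> set p" "(x, hd p) \<in> E" "dipath E p"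
    by (auto simp: dipath_Cons)
  show ?case
  proof (cases "v = hd p")
    case True
    then show ?thesis using p(2) by auto
  next
    case False
    then show ?thesis using Cons.IH p(1,3) by auto
  qed
qed (simp add: dipath_def)

lemma disjoint_family_on_setD:
  "disjoint_family_on set P \<Longrightarrow> p \<in> P \<Longrightarrow> q \<in> P \<Longrightarrow> x \<in> set p \<Longrightarrow> x \<in> set q \<Longrightarrow> p = q"
  unfolding disjoint_family_on_def by blast

context
  fixes V :: "'a set" and E P
  assumes P: "dipath_partition V E P"
begin

lemma partition_dipath: "p \<in> P \<Longrightarrow> dipath E p"
  using P by (simp add: dipath_partition_def)

lemma partition_nonempty: "p \<in> P \<Longrightarrow> p \<noteq> []"
  using partition_dipath by (auto simp: dipath_def)

lemma partition_eq: "p \<in> P \<Longrightarrow> q \<in> P \<Longrightarrow> x \<in> set p \<Longrightarrow> x \<in> set q \<Longrightarrow> p = q"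
  using P disjoint_family_on_setD[of P p q x] by (simp add: dipath_partition_def)

lemma partition_subset: "p \<in> P \<Longrightarrow> set p \<subseteq> V"
  using P by (auto simp: dipath_partition_def)

lemma partition_covers: "x \<in> V \<Longrightarrow> \<exists>p\<in>P. x \<in> set p"
  using P by (auto simp: dipath_partition_def)

lemma inj_on_hd_partition: "inj_on hd P"
proof (rule inj_onI)
  fix p q assume pq: "p \<in> P" "q \<in> P" "hd p = hd q"
  then have "hd p \<in> set p" "hd p \<in> set q"
    using partition_nonempty hd_in_set by metis+
  then show "p = q" using partition_eq pq by blast
qed

lemma partition_heads_subset: "hd ` P \<subseteq> V"
  using partition_nonempty partition_subset hd_in_set by (meson image_subsetI subsetD)

lemma finite_partition:
  assumes "finite V"
  shows "finite P"
  using finite_subset[OF partition_heads_subset assms] inj_on_hd_partition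
  by (rule finite_imageD)

lemma partition_prepend:
  assumes "q \<in> P" "x \<notin> V" "(x, hd q) \<in> E"
  shows "dipath_partition (insert x V) E (insert (x # q) (P - {q}))"
    and "hd ` insert (x # q) (P - {q}) = insert x (hd ` P - {hd q})"
proof -
  have "dipath E (x # q)"
    using assms partition_dipath[of q] partition_subset[of q] by (auto simp: dipath_Cons)
  moreover have "set (x # q) \<inter> set p = {}" if "p \<in> P - {q}" for p
    using that partition_subset[of p] partition_eq[OF assms(1), of p] assms(2) by auto
  then have "disjoint_family_on set (insert (x # q) (P - {q}))"
    using P by (auto simp: disjoint_family_on_def dipath_partition_def)
  ultimately show "dipath_partition (insert x V) E (insert (x # q) (P - {q}))"
    using P assms(1) by (auto simp: dipath_partition_def)
  show "hd ` insert (x # q) (P - {q}) = insert x (hd ` P - {hd q})"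
    using inj_on_image_set_diff[OF inj_on_hd_partition, of P "{q}"] assms(1) by auto
qed

lemma partition_add_singleton:
  assumes "x \<notin> V"
  shows "dipath_partition (insert x V) E (insert [x] P)"
  using P assms unfolding dipath_partition_def disjoint_family_on_def
  by (auto simp: dipath_def)

lemma partition_remove_singleton:
  assumes "[x] \<in> P"
  shows "dipath_partition (V - {x}) E (P - {[x]})"
    and "hd ` (P - {[x]}) = hd ` P - {x}"
proof -
  have "(\<Union>p\<in>P - {[x]}. set p) = V - {x}"
  proof -
    have V: "V = (\<Union>p\<in>P. set p)" using P by (simp add: dipath_partition_def)
    have "x \<notin> set p" if "p \<in> P - {[x]}" for p
      using partition_eq[OF assms, of p x] that by auto
    then show ?thesis using assms unfolding V by auto
  qed
  then show "dipath_partition (V - {x}) E (P - {[x]})"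
    using P by (auto simp: dipath_partition_def disjoint_family_on_def)
  show "hd ` (P - {[x]}) = hd ` P - {x}"
    using inj_on_image_set_diff[OF inj_on_hd_partition, of P "{[x]}"] assms by auto
qed

lemma partition_remove_head:
  assumes "x # r \<in> P" "r \<noteq> []"
  shows "dipath_partition (V - {x}) E (insert r (P - {x # r}))"
    and "hd ` insert r (P - {x # r}) = insert (hd r) (hd ` P - {x})"
    and "hd r \<notin> hd ` P"
    and "card (insert r (P - {x # r})) = card P"
proof -
  have x: "x \<notin> set r" and r: "dipath E r"
    using partition_dipath[OF assms(1)] assms(2) by (auto simp: dipath_Cons)
  have disj: "set p \<inter> set (x # r) = {}" if "p \<in> P - {x # r}" for p
    using partition_eq[OF _ assms(1)] that by auto
  have "(\<Union>p\<in>insert r (P - {x # r}). set p) = V - {x}"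
  proof -
    have "V = set (x # r) \<union> (\<Union>p\<in>P - {x # r}. set p)"
      using P assms(1) by (auto simp: dipath_partition_def)
    moreover have "x \<notin> (\<Union>p\<in>P - {x # r}. set p)"
      using disj by (metis IntI UN_E empty_iff list.set_intros(1))
    ultimately show ?thesis using x by auto
  qed
  moreover have "disjoint_family_on set (insert r (P - {x # r}))"
  proof -
    have "set r \<inter> set p = {}" if "p \<in> P - {x # r}" for p
      using disj[OF that] by auto
    then show ?thesis
      using P unfolding disjoint_family_on_def dipath_partition_def
      by (metis Diff_iff Int_commute insert_iff)
  qed
  ultimately show "dipath_partition (V - {x}) E (insert r (P - {x # r}))"
    using P r by (auto simp: dipath_partition_def)
  show "hd ` insert r (P - {x # r}) = insert (hd r) (hd ` P - {x})"
    using inj_on_image_set_diff[OF inj_on_hd_partition, of P "{x # r}"] assms(1) by auto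
  show "hd r \<notin> hd ` P"
  proof
    assume "hd r \<in> hd ` P"
    then obtain p where p: "p \<in> P" "hd p = hd r" by auto
    then have "hd r \<in> set p" "hd r \<in> set (x # r)"
      using partition_nonempty[OF p(1)] assms(2) hd_in_set[of p] by auto
    then have "p = x # r" using partition_eq[OF p(1) assms(1)] by blast
    then show False using p(2) x assms(2) hd_in_set[of r] by simp
  qed
  have "r \<notin> P"
    using disj[of r] assms(2) by (cases r) auto
  then show "card (insert r (P - {x # r})) = card P"
    using assms(1) card_Suc_Diff1[of P "x # r"] by (cases "finite P") simp_all
qed

end

lemma partition_singletons: "dipath_partition V E ((\<lambda>x. [x]) ` V)"
  by (auto simp: dipath_partition_def dipath_def disjoint_family_on_def)

section \<open>The Gallai--Milgram theorem\<close>

text \<open>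
  The initial vertices are too many to be stable, so there is an arc from one initial vertex
  \<open>x\<close> to another, \<open>y\<close>. If \<open>x\<close> is a path by itself, prepend it to the path of \<open>y\<close>. Otherwise
  delete \<open>x\<close>, so that its successor \<open>w\<close> becomes initial, and apply induction: as at least one
  initial vertex is lost, \<open>x\<close> can be put back in front of \<open>w\<close>, in front of \<open>y\<close>, or as a path
  by itself, and no vertex that was not initial before becomes initial. The inclusion of the sets
  of initial vertices, stronger than a bound on their number, is what makes the induction work.
\<close>

lemma gallai_milgram_step:
  assumes "finite V" "dipath_partition V E P"
    and "\<And>T. T \<subseteq> V \<Longrightarrow> indep E T \<Longrightarrow> card T < card P"
  shows "\<exists>P'. dipath_partition V E P' \<and> hd ` P' \<subset> hd ` P"
  using assms
proof (induction "card V" arbitrary: V P rule: less_induct)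
  case less
  note P = less.prems(2)
  define A where "A = hd ` P"
  have "card A = card P"
    using inj_on_hd_partition[OF P] unfolding A_def by (rule card_image)
  moreover have AV: "A \<subseteq> V"
    using partition_heads_subset[OF P] unfolding A_def .
  ultimately have "\<not> indep E A"
    using less.prems(3)[of A] by auto
  then obtain x y where xy: "x \<in> A" "y \<in> A" "x \<noteq> y" "(x, y) \<in> E"
    using indepI by metis
  obtain p where p: "p \<in> P" "hd p = x" using xy(1) unfolding A_def by blast
  obtain q where q: "q \<in> P" "hd q = y" using xy(2) unfolding A_def by blast
  have xV: "x \<in> V" using AV xy(1) by blast
  then have ins: "insert x (V - {x}) = V" by blast
  obtain r where r: "p = x # r"
    using p partition_nonempty[OF P p(1)] by (cases p) auto
  have "\<exists>P'. dipath_partition V E P' \<and> hd ` P' \<subset> A"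
  proof (cases "r = []")
    case True
    then have x: "[x] \<in> P" using p r by simp
    note P1 = partition_remove_singleton[OF P x, folded A_def]
    have "q \<in> P - {[x]}" using q xy(3) by auto
    note P2 = partition_prepend[OF P1(1) this, of x, unfolded ins q(2) P1(2)]
    have "insert x (A - {x} - {y}) \<subset> A" using xy by (intro psubsetI) auto
    then show ?thesis using P2 xy(4) by (metis Diff_iff singletonI)
  next
    case False
    then have x: "x # r \<in> P" using p r by simp
    let ?P1 = "insert r (P - {x # r})" and ?w = "hd r"
    note P1 = partition_remove_head[OF P x False, folded A_def]
    have "card (V - {x}) < card V"
      using less.prems(1) xV by (rule card_Diff1_less)
    moreover have "card T < card ?P1" if "T \<subseteq> V - {x}" "indep E T" for T
      using that less.prems(3)[of T] P1(4) by auto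
    ultimately obtain P2 where P2: "dipath_partition (V - {x}) E P2" "hd ` P2 \<subset> hd ` ?P1"
      using less.hyps[OF _ _ P1(1)] less.prems(1) by blast
    define B where "B = hd ` P2"
    have xw: "(x, ?w) \<in> E"
      using partition_dipath[OF P x] False by (auto simp: dipath_Cons)
    have x2: "x \<notin> B" using partition_heads_subset[OF P2(1)] unfolding B_def by blast
    have sub: "B \<subset> insert ?w (A - {x})" using P2(2) unfolding P1(2) B_def .
    have prep: "\<exists>P'. dipath_partition V E P' \<and> hd ` P' = insert x (B - {z})"
      if z: "z \<in> B" "(x, z) \<in> E" for z
    proof -
      obtain q2 where q2: "q2 \<in> P2" "hd q2 = z" using z(1) unfolding B_def by blast
      show ?thesis
        using partition_prepend[OF P2(1) q2(1), of x, folded B_def] z(2) q2(2) ins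
        by (metis Diff_iff singletonI)
    qed
    consider (w) "?w \<in> B" | (y) "?w \<notin> B" "y \<in> B" | (none) "?w \<notin> B" "y \<notin> B" by blast
    then show ?thesis
    proof cases
      case w
      obtain z where "z \<in> insert ?w (A - {x})" "z \<notin> B"
        using sub psubset_imp_ex_mem by (metis DiffE)
      then have "z \<in> A - insert x (B - {?w})" using w by blast
      moreover have "insert x (B - {?w}) \<subseteq> A" using sub xy(1) by auto
      ultimately have "insert x (B - {?w}) \<subset> A" by auto
      then show ?thesis using prep[OF w xw] by metis
    next
      case y
      have "insert x (B - {y}) \<subseteq> A" using sub y(1) xy(1) by auto
      moreover have "y \<in> A - insert x (B - {y})" using xy by auto
      ultimately have "insert x (B - {y}) \<subset> A" by auto
      then show ?thesis using prep[OF y(2) xy(4)] by metis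
    next
      case none
      have "insert x B \<subseteq> A" using sub none(1) xy(1) by auto
      moreover have "y \<in> A - insert x B" using none(2) xy by auto
      ultimately have "insert x B \<subset> A" by auto
      then show ?thesis
        using partition_add_singleton[OF P2(1), of x] ins B_def
        by (intro exI[of _ "insert [x] P2"]) auto
    qed
  qed
  then show ?case unfolding A_def .
qed

lemma gallai_milgram:
  assumes "finite V" "\<And>T. T \<subseteq> V \<Longrightarrow> indep E T \<Longrightarrow> card T \<le> k"
  shows "\<exists>P. dipath_partition V E P \<and> card P \<le> k"
proof -
  let ?part = "dipath_partition V E"
  define P where "P = arg_min card ?part"
  have P: "?part P" "\<And>P'. ?part P' \<Longrightarrow> card P \<le> card P'"
    using arg_min_nat_lemma[of ?part, OF partition_singletons] unfolding P_def by auto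
  have "card P \<le> k"
  proof (rule ccontr)
    assume "\<not> card P \<le> k"
    then obtain P' where P': "?part P'" "hd ` P' \<subset> hd ` P"
      using gallai_milgram_step[OF assms(1) P(1)] assms(2) by (meson le_less_trans not_le)
    then have "card (hd ` P') < card (hd ` P)"
      using finite_partition[OF P(1) assms(1)] by (intro psubset_card_mono) auto
    then show False
      using P(2)[OF P'(1)] card_image[OF inj_on_hd_partition[OF P(1)]]
        card_image[OF inj_on_hd_partition[OF P'(1)]] by simp
  qed
  then show ?thesis using P(1) by blast
qed

section \<open>Partitions rooted at a maximum stable set\<close>

text \<open>
  Delete all arcs into \<open>S\<close>. By the assumption on opposite arcs each deleted arc leaves
  its reversal behind, so \<open>S\<close> is still maximum, and Gallai--Milgram gives at most \<open>card S\<close> paths.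
  A vertex of \<open>S\<close> now has no predecessor and must be initial, hence \<open>S\<close> is exactly the
  set of initial vertices.
\<close>

lemma rooted_partition_exists:
  assumes "finite V" "max_indep V E S"
    and out: "\<And>v s. v \<in> V \<Longrightarrow> s \<in> S \<Longrightarrow> (v, s) \<in> E \<Longrightarrow> (s, v) \<in> E"
  shows "\<exists>P. rooted_partition V E S P"
proof -
  have S: "S \<subseteq> V" "indep E S" "\<And>T. T \<subseteq> V \<Longrightarrow> indep E T \<Longrightarrow> card T \<le> card S"
    using assms(2) unfolding max_indep_def by blast+
  define E' where "E' = {(x, y) \<in> E. y \<notin> S}"
  have "indep E T" if T: "T \<subseteq> V" "indep E' T" for T
  proof (rule indepI)
    fix x y assume xy: "x \<in> T" "y \<in> T" "x \<noteq> y"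
    then have n: "(x, y) \<notin> E'" "(y, x) \<notin> E'" using indepD[OF T(2)] by auto
    show "(x, y) \<notin> E"
    proof
      assume e: "(x, y) \<in> E"
      then have y: "y \<in> S" using n(1) by (auto simp: E'_def)
      then have "x \<notin> S" using indepD[OF S(2)] e xy(3) by blast
      then show False using out[of x y] e y n(2) T(1) xy(1) by (auto simp: E'_def)
    qed
  qed
  then obtain P where P: "dipath_partition V E' P" "card P \<le> card S"
    using gallai_milgram[OF assms(1), of E' "card S"] S(3) by blast
  have head: "v = hd p" if "p \<in> P" "v \<in> set p" "v \<in> S" for p v
    using dipath_into_head[OF partition_dipath[OF P(1) that(1)] that(2)] that(3)
    by (auto simp: E'_def)
  have fin: "finite (hd ` P)" using finite_partition[OF P(1) assms(1)] by simp
  have "S \<subseteq> hd ` P"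
    using head partition_covers[OF P(1)] S(1) by blast
  moreover have "card (hd ` P) \<le> card S"
    using P(2) card_image[OF inj_on_hd_partition[OF P(1)]] by simp
  ultimately have hds: "S = hd ` P" using fin card_seteq by blast
  have "set p \<inter> S = {hd p}" if "p \<in> P" for p
    using head[OF that] hds that partition_nonempty[OF P(1) that] by auto
  moreover have "dipath E p" if "p \<in> P" for p
    using dipath_mono[OF partition_dipath[OF P(1) that], of E] by (auto simp: E'_def)
  ultimately show ?thesis
    using P(1) unfolding rooted_partition_def dipath_partition_def by blast
qed

lemma rooted_partition_heads:
  assumes "rooted_partition V E S P" "S \<subseteq> V"
  shows "hd ` P = S"
proof
  show "hd ` P \<subseteq> S" using assms(1) unfolding rooted_partition_def by blast
  show "S \<subseteq> hd ` P"
  proof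
    fix s assume s: "s \<in> S"
    then obtain p where "p \<in> P" "s \<in> set p"
      using partition_covers[of V E P s] assms unfolding rooted_partition_def by blast
    then have "s = hd p" using assms(1) s unfolding rooted_partition_def by blast
    then show "s \<in> hd ` P" using \<open>p \<in> P\<close> by simp
  qed
qed

text \<open>
  This is usually derived from Hall's theorem. Here it follows from the previous results: partition
  the bipartite graph on \<open>S \<union> U\<close> into paths beginning in \<open>S\<close> and otherwise in \<open>U - S\<close>. As \<open>U\<close> is
  stable these paths have at most two vertices, so each vertex of \<open>U - S\<close> is the
  second vertex of a path, which matches it to the first.
\<close>

lemma max_indep_matching:
  assumes "finite V" "max_indep V E S" "max_indep V E U"
  shows "\<exists>g. bij_betw g (U - S) (S - U) \<and> (\<forall>u\<in>U - S. (g u, u) \<in> E \<or> (u, g u) \<in> E)"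
proof -
  let ?F = "E \<union> E\<inverse>"
  have S: "max_indep V ?F S" and U: "max_indep V ?F U"
    using assms max_indep_cong[of V E _ ?F] by auto
  have sub: "S \<subseteq> V" "U \<subseteq> V" using S U by (simp_all add: max_indep_def)
  then have fin: "finite S" "finite U" using assms(1) finite_subset by blast+
  have card: "card S = card U"
    using S U unfolding max_indep_def by (metis le_antisym)
  have "max_indep (S \<union> U) ?F S"
    using S sub unfolding max_indep_def by (meson Un_least Un_upper1 order_trans)
  then obtain P where P: "rooted_partition (S \<union> U) ?F S P"
    using rooted_partition_exists[of "S \<union> U" ?F S] fin by auto
  then have part: "dipath_partition (S \<union> U) ?F P"
    and rt: "\<And>p. p \<in> P \<Longrightarrow> set p \<inter> S = {hd p}"
    by (auto simp: rooted_partition_def)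
  have "\<exists>s. [s, u] \<in> P" if u: "u \<in> U - S" for u
  proof -
    obtain p where p: "p \<in> P" "u \<in> set p"
      using partition_covers[OF part] u by blast
    obtain s r where sr: "p = s # r"
      using partition_nonempty[OF part p(1)] by (cases p) auto
    have path: "dipath ?F p" using partition_dipath[OF part p(1)] .
    have "set r \<subseteq> U"
      using rt[OF p(1)] partition_subset[OF part p(1)] path by (auto simp: sr dipath_Cons)
    then have "length r \<le> 1"
      using path U indepD[of ?F U] unfolding sr max_indep_def
      by (cases r; cases "tl r") (auto simp: dipath_Cons)
    moreover have "u \<in> set r" using p(2) u rt[OF p(1)] sr by auto
    ultimately have "r = [u]" by (cases r) auto
    then show ?thesis using p(1) sr by auto
  qed
  then obtain g where g: "\<And>u. u \<in> U - S \<Longrightarrow> [g u, u] \<in> P" by metis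
  have edge: "(g u, u) \<in> ?F" and gS: "g u \<in> S" if "u \<in> U - S" for u
    using partition_dipath[OF part g[OF that]] rt[OF g[OF that]] by (auto simp: dipath_Cons)
  have gU: "g u \<notin> U" if "u \<in> U - S" for u
    using edge[OF that] gS[OF that] that U unfolding max_indep_def
    by (metis DiffD1 DiffD2 indepD)
  have inj: "inj_on g (U - S)"
  proof (rule inj_onI)
    fix u v assume uv: "u \<in> U - S" "v \<in> U - S" "g u = g v"
    then have "[g u, u] = [g v, v]"
      using partition_eq[OF part g[OF uv(1)] g[OF uv(2)], of "g u"] by simp
    then show "u = v" by simp
  qed
  have "card (U - S) = card (S - U)"
    using card fin card_Diff_subset_Int[of U S] card_Diff_subset_Int[of S U]
    by (simp add: Int_commute)
  then have "g ` (U - S) = S - U"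
    using gS gU fin inj by (intro card_subset_eq) (auto simp: card_image)
  then show ?thesis using inj edge by (intro exI[of _ g]) (auto simp: bij_betw_def)
qed


text \<open>
  The choice of \<open>U\<close> and \<open>g\<close> prescribes the first arc of every path that begins in \<open>S - U\<close>.
\<close>

lemma rooted_partition_link:
  assumes S: "S \<subseteq> V" and g: "bij_betw g (U - S) (S - U)"
    and edge: "\<And>u. u \<in> U - S \<Longrightarrow> (g u, u) \<in> E"
    and Q: "rooted_partition (V - (S - U)) E U Q" and U: "U \<subseteq> V"
  shows "rooted_partition V E S ((\<lambda>q. if hd q \<in> S then q else g (hd q) # q) ` Q)"
proof -
  let ?h = "\<lambda>q. if hd q \<in> S then q else g (hd q) # q"
  have part: "dipath_partition (V - (S - U)) E Q"
    and rt: "\<And>q. q \<in> Q \<Longrightarrow> set q \<inter> U = {hd q}"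
    using Q unfolding rooted_partition_def by blast+
  have hds: "hd ` Q = U" using rooted_partition_heads[OF Q] U by blast
  have gim: "g u \<in> S - U" if "u \<in> U - S" for u
    using g that by (rule bij_betw_apply)
  have hdU: "hd q \<in> U" if "q \<in> Q" for q using hds that by blast
  have sub: "set q \<subseteq> V - (S - U)" if "q \<in> Q" for q
    using partition_subset[OF part that] .
  have path: "dipath E (?h q)" if "q \<in> Q" for q
    using partition_dipath[OF part that] sub[OF that] gim[of "hd q"] edge[of "hd q"]
      hdU[OF that] by (auto simp: dipath_Cons)
  have root: "set (?h q) \<inter> S = {hd (?h q)}" if q: "q \<in> Q" for q
  proof -
    have hq: "hd q \<in> set q" using rt[OF q] by blast
    have inS: "set q \<inter> S \<subseteq> {hd q}" using rt[OF q] sub[OF q] by blast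
    show ?thesis
    proof (cases "hd q \<in> S")
      case True
      then show ?thesis using hq inS by auto
    next
      case False
      then have "set q \<inter> S = {}" using inS by blast
      then show ?thesis using False gim[of "hd q"] hdU[OF q] by simp
    qed
  qed
  have disj: "set (?h p) \<inter> set (?h q) = {}" if pq: "p \<in> Q" "q \<in> Q" "p \<noteq> q" for p q
  proof -
    have "set p \<inter> set q = {}" using partition_eq[OF part pq(1,2)] pq(3) by blast
    moreover have "g (hd p) \<noteq> g (hd q)" if "hd p \<notin> S" "hd q \<notin> S"
      using that hdU[OF pq(1)] hdU[OF pq(2)] inj_onD[OF inj_on_hd_partition[OF part]] pq
        inj_onD[OF bij_betw_imp_inj_on[OF g], of "hd p" "hd q"] by blast
    moreover have "g (hd p) \<notin> set q" if "hd p \<notin> S"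
      using that sub[OF pq(2)] gim hdU[OF pq(1)] by blast
    moreover have "g (hd q) \<notin> set p" if "hd q \<notin> S"
      using that sub[OF pq(1)] gim hdU[OF pq(2)] by blast
    ultimately show ?thesis by (simp, metis)
  qed
  have "(\<Union>q\<in>Q. set (?h q)) = V"
  proof
    show "(\<Union>q\<in>Q. set (?h q)) \<subseteq> V"
    proof (intro UN_least)
      fix q assume q: "q \<in> Q"
      show "set (?h q) \<subseteq> V"
        using sub[OF q] gim[of "hd q"] hdU[OF q] S by auto
    qed
    show "V \<subseteq> (\<Union>q\<in>Q. set (?h q))"
    proof
      fix v assume v: "v \<in> V"
      show "v \<in> (\<Union>q\<in>Q. set (?h q))"
      proof (cases "v \<in> S - U")
        case True
        then obtain u where u: "u \<in> U - S" "v = g u"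
          using g by (metis bij_betw_imp_surj_on imageE)
        then obtain q where "q \<in> Q" "hd q = u" using hds by blast
        then show ?thesis using u by (intro UN_I[of q]) auto
      next
        case False
        then obtain q where "q \<in> Q" "v \<in> set q" using partition_covers[OF part] v by blast
        then show ?thesis by (intro UN_I[of q]) auto
      qed
    qed
  qed
  then have "(\<Union>p\<in>?h ` Q. set p) = V" by blast
  moreover have "disjoint_family_on set (?h ` Q)"
    unfolding disjoint_family_on_def using disj by blast
  moreover have "\<forall>p\<in>?h ` Q. dipath E p" using path by blast
  moreover have "\<forall>p\<in>?h ` Q. set p \<inter> S = {hd p}" using root by blast
  ultimately show ?thesis
    unfolding rooted_partition_def dipath_partition_def by (intro conjI)
qed

section \<open>Begin-end partitions\<close>

definition begin_end_partition ::
    "'a set \<Rightarrow> ('a \<times> 'a) set \<Rightarrow> 'a set \<Rightarrow> 'a list set \<Rightarrow> bool" where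
  "begin_end_partition V E S P \<longleftrightarrow>
     dipath_partition V E P \<and> (\<forall>p\<in>P. \<exists>x\<in>{hd p, last p}. set p \<inter> S = {x})"

lemma begin_end_partition_orient:
  assumes P: "rooted_partition V F S P"
    and orient: "\<And>p. p \<in> P \<Longrightarrow> dipath E p \<or> dipath E (rev p)"
  shows "\<exists>P'. begin_end_partition V E S P'"
proof -
  let ?o = "\<lambda>p. if dipath E p then p else rev p"
  have part: "dipath_partition V F P" and rt: "\<And>p. p \<in> P \<Longrightarrow> set p \<inter> S = {hd p}"
    using P unfolding rooted_partition_def by blast+
  have set: "set (?o p) = set p" for p by simp
  have "disjoint_family_on set (?o ` P)"
    unfolding disjoint_family_on_def
  proof (intro ballI impI)
    fix p' q' assume "p' \<in> ?o ` P" "q' \<in> ?o ` P" "p' \<noteq> q'"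
    then obtain p q where "p \<in> P" "q \<in> P" "p \<noteq> q" "p' = ?o p" "q' = ?o q" by blast
    then show "set p' \<inter> set q' = {}"
      using partition_eq[OF part \<open>p \<in> P\<close> \<open>q \<in> P\<close>] set by blast
  qed
  moreover have "(\<Union>p\<in>?o ` P. set p) = V"
  proof -
    have "(\<Union>p\<in>?o ` P. set p) = (\<Union>p\<in>P. set (?o p))" by blast
    also have "\<dots> = V" using part unfolding set dipath_partition_def by blast
    finally show ?thesis .
  qed
  moreover have "dipath E (?o p)" if "p \<in> P" for p
    using orient[OF that] by auto
  moreover have "\<exists>x\<in>{hd (?o p), last (?o p)}. set (?o p) \<inter> S = {x}" if "p \<in> P" for p
    using rt[OF that] by (auto simp: last_rev)
  ultimately show ?thesis
    unfolding begin_end_partition_def dipath_partition_def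
    by (intro exI[of _ "?o ` P"]) blast
qed

text \<open>
  In the symmetric closure only the first arc of a path can be missing from \<open>E\<close>, because
  the later vertices lie outside \<open>S\<close>; if it is missing, all arcs of the path are present in the
  opposite direction.
\<close>

lemma begin_end_no_lonely_outside:
  assumes "finite V" "max_indep V E S"
    and inner: "\<And>x y. x \<notin> S \<Longrightarrow> y \<notin> S \<Longrightarrow> (x, y) \<in> E \<Longrightarrow> (y, x) \<in> E"
  shows "\<exists>P. begin_end_partition V E S P"
proof -
  let ?F = "E \<union> E\<inverse>"
  have "max_indep V ?F S"
    by (rule max_indep_cong[OF assms(2)]) auto
  then obtain P where P: "rooted_partition V ?F S P"
    using rooted_partition_exists[OF assms(1), of ?F S] by blast
  have "dipath E p \<or> dipath E (rev p)" if p: "p \<in> P" for p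
  proof -
    have path: "dipath ?F p" and rt: "set p \<inter> S = {hd p}"
      using P p unfolding rooted_partition_def dipath_partition_def by blast+
    obtain s r where sr: "p = s # r"
      using path by (cases p) (auto simp: dipath_def)
    have r: "r = [] \<or> (s, hd r) \<in> ?F \<and> dipath ?F r" and s: "s \<notin> set r"
      using path by (auto simp: sr dipath_Cons)
    have out: "x \<notin> S" if "x \<in> set r" for x using rt s that by (auto simp: sr)
    have both: "dipath E r" "dipath (E\<inverse>) r" if "dipath ?F r"
      using dipath_mono[OF that, of E] dipath_mono[OF that, of "E\<inverse>"] out inner by blast+
    have "dipath E p \<or> dipath (E\<inverse>) p"
      using r s both by (auto simp: sr dipath_Cons)
    then show ?thesis by (simp add: dipath_rev)
  qed
  then show ?thesis by (rule begin_end_partition_orient[OF P])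
qed

lemma begin_end_no_lonely_into:
  assumes "finite V" "max_indep V E S"
    and "\<And>v s. s \<in> S \<Longrightarrow> (v, s) \<in> E \<Longrightarrow> (s, v) \<in> E"
  shows "\<exists>P. begin_end_partition V E S P"
proof -
  obtain P where P: "rooted_partition V E S P"
    using rooted_partition_exists[OF assms(1,2)] assms(3) by blast
  then have "dipath E p" if "p \<in> P" for p
    using that unfolding rooted_partition_def dipath_partition_def by blast
  then show ?thesis using begin_end_partition_orient[OF P] by blast
qed

lemma begin_end_no_lonely_out_of:
  assumes "finite V" "max_indep V E S"
    and "\<And>v s. s \<in> S \<Longrightarrow> (s, v) \<in> E \<Longrightarrow> (v, s) \<in> E"
  shows "\<exists>P. begin_end_partition V E S P"
proof -
  have "max_indep V (E\<inverse>) S" by (rule max_indep_cong[OF assms(2)]) auto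
  then obtain P where P: "rooted_partition V (E\<inverse>) S P"
    using rooted_partition_exists[OF assms(1), of "E\<inverse>" S] assms(3) by blast
  then have "dipath E (rev p)" if "p \<in> P" for p
    using that unfolding rooted_partition_def dipath_partition_def dipath_rev by blast
  then show ?thesis using begin_end_partition_orient[OF P] by blast
qed

text \<open>
  The heart of the proof. Paths beginning in \<open>S\<close> fail when they leave \<open>b\<close> for \<open>b'\<close>; the two
  cases below either use \<open>b' b\<close> as a path by itself or force \<open>b\<close> to be followed by another vertex.
\<close>

lemma begin_end_three_lonely:
  assumes fin: "finite V" and EV: "E \<subseteq> V \<times> V" and maxS: "max_indep V E S"
    and lonely: "E - E\<inverse> = {(a, a'), (b', b), (c, d)}"
    and dist: "distinct [a, a', b', b, c, d]"
    and S: "a \<in> S" "b \<in> S" "c \<notin> S" "d \<notin> S"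
  shows "\<exists>P. begin_end_partition V E S P"
proof -
  have arcs: "(a, a') \<in> E" "(b', b) \<in> E" "(c, d) \<in> E" using lonely by auto
  have rev_arc: "(y, x) \<in> E"
    if "(x, y) \<in> E" "(x, y) \<noteq> (a, a')" "(x, y) \<noteq> (b', b)" "(x, y) \<noteq> (c, d)" for x y
  proof (rule ccontr)
    assume "(y, x) \<notin> E"
    then have "(x, y) \<in> E - E\<inverse>" using that(1) by simp
    then have "(x, y) \<in> {(a, a'), (b', b), (c, d)}" unfolding lonely .
    then show False using that by auto
  qed
  have SV: "S \<subseteq> V" "indep E S" "\<And>T. T \<subseteq> V \<Longrightarrow> indep E T \<Longrightarrow> card T \<le> card S"
    using maxS unfolding max_indep_def by blast+
  have finS: "finite S" using SV(1) fin finite_subset by blast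
  have neq: "a \<noteq> a'" "b' \<noteq> b" using dist by simp_all
  have S': "a' \<notin> S" "b' \<notin> S"
    using indepD[OF SV(2) S(1)] indepD[OF SV(2) _ S(2)] arcs neq by blast+
  show ?thesis
  proof (cases "\<exists>U. U \<subseteq> V - {b, b'} \<and> indep E U \<and> card U = card S")
    case False
    let ?V = "V - {b, b'}" and ?S = "S - {b}"
    have "max_indep ?V E ?S"
      unfolding max_indep_def
    proof (intro conjI allI impI)
      show "?S \<subseteq> ?V" using SV(1) S' by auto
      show "indep E ?S" using SV(2) indep_subset by blast
      fix T assume T: "T \<subseteq> ?V" "indep E T"
      then have "card T \<noteq> card S" "card T \<le> card S" using False SV(3)[of T] by auto
      then show "card T \<le> card ?S" using finS S(2) by simp
    qed
    moreover have "(s, v) \<in> E" if "s \<in> ?S" "(v, s) \<in> E" for v s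
      using that rev_arc[of v s] S S' by auto
    ultimately obtain P where P: "rooted_partition ?V E ?S P"
      using rooted_partition_exists[of ?V E ?S] fin by blast
    then have part: "dipath_partition ?V E P" and rt: "\<And>p. p \<in> P \<Longrightarrow> set p \<inter> ?S = {hd p}"
      unfolding rooted_partition_def by blast+
    have b: "[b] \<notin> P" using partition_subset[OF part, of "[b]"] by auto
    have "dipath_partition (insert b ?V) E (insert [b] P)"
      using part by (rule partition_add_singleton) simp
    then have "dipath_partition (insert b' (insert b ?V)) E (insert [b', b] (insert [b] P - {[b]}))"
      by (rule partition_prepend(1)) (use arcs dist in auto)
    moreover have "insert b' (insert b ?V) = V" using arcs EV by auto
    ultimately have "dipath_partition V E (insert [b', b] P)" using b by simp
    moreover have "set p \<inter> S = {hd p}" if "p \<in> P" for p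
      using rt[OF that] partition_subset[OF part that] by auto
    ultimately have "begin_end_partition V E S (insert [b', b] P)"
      unfolding begin_end_partition_def using S(2) S'(2) by auto
    then show ?thesis by blast
  next
    case True
    then obtain U where U: "U \<subseteq> V - {b, b'}" "indep E U" "card U = card S" by blast
    then have maxU: "max_indep V E U" using SV(3) unfolding max_indep_def by auto
    obtain g where g: "bij_betw g (U - S) (S - U)"
      and adj: "\<And>u. u \<in> U - S \<Longrightarrow> (g u, u) \<in> E \<or> (u, g u) \<in> E"
      using max_indep_matching[OF fin maxS maxU] by blast
    have gS: "g u \<in> S - U" if "u \<in> U - S" for u using g that by (rule bij_betw_apply)
    \<comment> \<open>The only lonely arc into \<open>S\<close> starts at \<open>b'\<close>, which is not in \<open>U\<close>.\<close>
    have edge: "(g u, u) \<in> E" if u: "u \<in> U - S" for u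
      using adj[OF u] rev_arc[of u "g u"] gS[OF u] S S' U(1) u by auto
    \<comment> \<open>No lonely arc may enter \<open>U\<close> from the vertices outside \<open>S - U\<close>. Only \<open>c \<rightarrow> d\<close> can do so,
      as \<open>b \<notin> U\<close>, and \<open>a \<in> S - U\<close> if \<open>a' \<in> U\<close>. It is then turned around.\<close>
    define F where "F = (if d \<in> U then insert (d, c) (E - {(c, d)}) else E)"
    let ?R = "V - (S - U)"
    have nU: "\<not> (x \<in> U \<and> y \<in> U)" if "(x, y) \<in> E" "x \<noteq> y" for x y
      using indepD[OF U(2)] that by blast
    have "max_indep V F U"
      by (rule max_indep_cong[OF maxU]) (use arcs in \<open>auto simp: F_def\<close>)
    then have "max_indep ?R F U"
      using U(1) unfolding max_indep_def by auto
    moreover have "(u, v) \<in> F" if v: "v \<in> ?R" and u: "u \<in> U" and vu: "(v, u) \<in> F" for v u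
    proof -
      have cd: "\<not> (c \<in> U \<and> d \<in> U)" and aa: "\<not> (a \<in> U \<and> a' \<in> U)"
        using nU arcs dist by auto
      have "(v, u) \<noteq> (d, c)" if "d \<in> U" using that u cd by auto
      then have vuE: "(v, u) \<in> E" "(v, u) \<noteq> (c, d)"
        using vu u unfolding F_def by (auto split: if_splits)
      moreover have "(v, u) \<noteq> (a, a')" using v u aa S(1) by auto
      moreover have "(v, u) \<noteq> (b', b)" using u U(1) by auto
      ultimately have "(u, v) \<in> E" using rev_arc by blast
      moreover have "(u, v) \<noteq> (c, d)" if "d \<in> U" using that u cd by auto
      ultimately show ?thesis unfolding F_def by auto
    qed
    ultimately obtain Q where Q: "rooted_partition ?R F U Q"
      using rooted_partition_exists[of ?R F U] fin by blast
    have "(g u, u) \<in> F" if "u \<in> U - S" for u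
      using edge[OF that] gS[OF that] S(3) by (auto simp: F_def)
    then have P: "rooted_partition V F S ((\<lambda>q. if hd q \<in> S then q else g (hd q) # q) ` Q)"
      using rooted_partition_link[OF SV(1) g _ Q] U(1) by blast
    show ?thesis
    proof (rule begin_end_partition_orient[OF P])
      fix p assume "p \<in> (\<lambda>q. if hd q \<in> S then q else g (hd q) # q) ` Q"
      then obtain q where q: "q \<in> Q" "p = (if hd q \<in> S then q else g (hd q) # q)" by blast
      have p: "dipath F p"
        using P q unfolding rooted_partition_def dipath_partition_def by blast
      have qF: "dipath F q" and qU: "set q \<inter> U = {hd q}" and qR: "set q \<subseteq> ?R"
        using Q q(1) unfolding rooted_partition_def dipath_partition_def by blast+
      have hdU: "hd q \<in> U" using qU by blast
      have qhd: "x = hd q" if "x \<in> set q" "x \<in> U" for x using qU that by blast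
      show "dipath E p \<or> dipath E (rev p)"
      proof (cases "d \<in> U \<and> hd q = d")
        case False
        \<comment> \<open>Only a path through \<open>d\<close> can use the arc that was turned around.\<close>
        have "d \<notin> set p" if "d \<in> U"
        proof -
          have "d \<notin> set q" using that False qhd[of d] by metis
          moreover have "d \<noteq> g (hd q)" if "hd q \<notin> S"
            using that hdU gS[of "hd q"] S(4) by blast
          ultimately show ?thesis using q(2) by simp
        qed
        then have "dipath E p"
          using dipath_mono[OF p, of E] by (fastforce simp: F_def split: if_splits)
        then show ?thesis ..
      next
        case True
        then have pd: "p = g d # q" using q(2) S(4) by simp
        have dU: "d \<in> U - S" using True S(4) by blast
        \<comment> \<open>The vertices \<open>a\<close> and \<open>b\<close> lie in \<open>S\<close>, and \<open>q\<close> has no vertex of \<open>S\<close>, so all arcs of \<open>q\<close>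
          can be reversed. So can the first arc of \<open>p\<close>, since the only lonely arc at \<open>d\<close>
          comes from \<open>c\<close>.\<close>
        have ab: "a \<notin> set q" "b \<notin> set q"
          using qR qhd[of a] S U(1) True dist by auto
        have "dipath (E\<inverse>) q"
        proof (rule dipath_mono[OF qF])
          fix x y assume xy: "x \<in> set q" "y \<in> set q" "(x, y) \<in> F"
          then have "(x, y) = (d, c) \<or> (x, y) \<in> E \<and> (x, y) \<noteq> (c, d)"
            using True by (auto simp: F_def)
          then show "(x, y) \<in> E\<inverse>" using rev_arc[of x y] xy(1,2) ab arcs(3) by auto
        qed
        moreover have "(d, g d) \<in> E"
          using rev_arc[OF edge[OF dU]] gS[OF dU] S(3) dist by auto
        ultimately have "dipath (E\<inverse>) p"
          using p True by (auto simp: pd dipath_Cons)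
        then show ?thesis by (simp add: dipath_rev)
      qed
    qed
  qed
qed

text \<open>
  With at most three lonely arcs, either one of the three kinds (entering \<open>S\<close>, leaving \<open>S\<close>,
  avoiding \<open>S\<close>) does not occur, or each kind occurs exactly once.
\<close>

lemma begin_end_lonely_matching:
  assumes fin: "finite V" and EV: "E \<subseteq> V \<times> V" and irrefl: "\<And>x. (x, x) \<notin> E"
    and maxS: "max_indep V E S" and card: "card (E - E\<inverse>) \<le> 3"
    and matching: "\<And>x y u v. (x, y) \<in> E - E\<inverse> \<Longrightarrow> (u, v) \<in> E - E\<inverse> \<Longrightarrow> (x, y) \<noteq> (u, v) \<Longrightarrow>
          {x, y} \<inter> {u, v} = {}"
  shows "\<exists>P. begin_end_partition V E S P"
proof -
  let ?L = "E - E\<inverse>"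
  consider (no_in) "\<forall>v s. s \<in> S \<longrightarrow> (v, s) \<notin> ?L" | (no_out) "\<forall>v s. s \<in> S \<longrightarrow> (s, v) \<notin> ?L"
    | (no_outside) "\<forall>x y. x \<notin> S \<longrightarrow> y \<notin> S \<longrightarrow> (x, y) \<notin> ?L"
    | (all) a a' b b' c d where "a \<in> S" "(a, a') \<in> ?L" "b \<in> S" "(b', b) \<in> ?L"
        "c \<notin> S" "d \<notin> S" "(c, d) \<in> ?L"
    by metis
  then show ?thesis
  proof cases
    case no_in
    then show ?thesis using begin_end_no_lonely_into[OF fin maxS] by blast
  next
    case no_out
    then show ?thesis using begin_end_no_lonely_out_of[OF fin maxS] by blast
  next
    case no_outside
    then show ?thesis using begin_end_no_lonely_outside[OF fin maxS] by blast
  next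
    case (all a a' b b' c d)
    have ind: "indep E S" using maxS by (simp add: max_indep_def)
    have S': "a' \<notin> S" "b' \<notin> S"
      using indepD[OF ind] all irrefl by blast+
    have ne: "(a, a') \<noteq> (b', b)" "(a, a') \<noteq> (c, d)" "(b', b) \<noteq> (c, d)"
      using all S' by auto
    have irr: "a \<noteq> a'" "b \<noteq> b'" "c \<noteq> d" using all irrefl by blast+
    have dist: "distinct [a, a', b', b, c, d]"
      using matching[OF all(2,4) ne(1)] matching[OF all(2,7) ne(2)]
        matching[OF all(4,7) ne(3)] irr by auto
    have "finite ?L" using EV fin finite_subset by blast
    moreover have "{(a, a'), (b', b), (c, d)} \<subseteq> ?L" using all by blast
    moreover have "card {(a, a'), (b', b), (c, d)} = 3" using ne by simp
    ultimately have "?L = {(a, a'), (b', b), (c, d)}"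
      using card card_seteq by metis
    then show ?thesis
      using begin_end_three_lonely[OF fin EV maxS _ dist] all by blast
  qed
qed

section \<open>Transfer to digraphs\<close>

lemma vwalk_arcs_subset_iff:
  "set (vwalk_arcs p) \<subseteq> E \<longleftrightarrow> successively (\<lambda>x y. (x, y) \<in> E) p"
  by (induction p rule: vwalk_arcs.induct) auto

lemma vpath_iff_dipath: "vpath p D \<longleftrightarrow> set p \<subseteq> verts D \<and> dipath (arcs_ends D) p"
  unfolding vpath_def vwalk_def dipath_def vwalk_arcs_subset_iff by (rule iffI) simp_all

lemma stable_set_iff_indep: "stable_set D S \<longleftrightarrow> S \<subseteq> verts D \<and> indep (arcs_ends D) S"
proof -
  have "pairwise (\<lambda>u v. \<not> adjacent D u v) S \<longleftrightarrow> indep (arcs_ends D) S"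
    unfolding indep_def pairwise_def adjacent_def by metis
  then show ?thesis by (simp add: stable_set_def)
qed

lemma path_partition_iff:
  "path_partition D P \<longleftrightarrow> dipath_partition (verts D) (arcs_ends D) P"
proof -
  have "(\<forall>p\<in>P. vpath p D) \<longleftrightarrow> (\<forall>p\<in>P. dipath (arcs_ends D) p)"
    if "(\<Union>p\<in>P. set p) = verts D"
  proof (rule ball_cong)
    fix p assume "p \<in> P"
    then have "set p \<subseteq> verts D" using that by (metis UN_upper)
    then show "vpath p D = dipath (arcs_ends D) p" by (simp add: vpath_iff_dipath)
  qed simp
  then show ?thesis
    unfolding path_partition_def dipath_partition_def by (auto simp del: UN_simps)
qed

lemma BE_path_partition_iff:
  "BE_path_partition D S P \<longleftrightarrow> begin_end_partition (verts D) (arcs_ends D) S P"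
  by (simp add: BE_path_partition_def begin_end_partition_def path_partition_iff)

lemma lonely_arcs_ends: "arcs_ends D - (arcs_ends D)\<inverse> = arc_to_ends D ` lonely_arcs D"
proof (intro set_eqI iffI)
  fix p assume p: "p \<in> arcs_ends D - (arcs_ends D)\<inverse>"
  then obtain e where e: "e \<in> arcs D" "p = (tail D e, head D e)"
    by (auto simp: arcs_ends_conv)
  then have "e \<in> lonely_arcs D" using p by (simp add: lonely_arcs_def)
  then show "p \<in> arc_to_ends D ` lonely_arcs D"
    using e(2) by (simp add: arc_to_ends_def)
next
  fix p assume "p \<in> arc_to_ends D ` lonely_arcs D"
  then obtain e where e: "e \<in> lonely_arcs D" "p = (tail D e, head D e)"
    by (auto simp: arc_to_ends_def)
  then have "p \<in> arcs_ends D" by (simp add: arcs_ends_conv lonely_arcs_def)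
  then show "p \<in> arcs_ends D - (arcs_ends D)\<inverse>" using e by (simp add: lonely_arcs_def)
qed

lemma lonely_arcs_induced:
  assumes "induced_subgraph H D"
  shows "lonely_arcs H \<subseteq> lonely_arcs D"
proof
  fix e assume e: "e \<in> lonely_arcs H"
  have H: "arcs H = {e \<in> arcs D. tail D e \<in> verts H \<and> head D e \<in> verts H}"
    and compat: "tail H = tail D" "head H = head D"
    using assms unfolding induced_subgraph_def subgraph_def compatible_def by simp_all
  have eH: "e \<in> arcs H" "(head D e, tail D e) \<notin> arcs_ends H"
    using e unfolding lonely_arcs_def compat by simp_all
  then have ends: "tail D e \<in> verts H" "head D e \<in> verts H" "e \<in> arcs D"
    unfolding H by simp_all
  have "(head D e, tail D e) \<notin> arcs_ends D"
  proof
    assume "(head D e, tail D e) \<in> arcs_ends D"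
    then obtain f where f: "f \<in> arcs D" "tail D f = head D e" "head D f = tail D e"
      by (auto simp: arcs_ends_conv)
    then have "f \<in> arcs H" unfolding H using ends by simp
    then have "(tail D f, head D f) \<in> arcs_ends H" unfolding arcs_ends_conv compat by simp
    then show False using eH(2) f by simp
  qed
  then show "e \<in> lonely_arcs D" using ends(3) by (simp add: lonely_arcs_def)
qed

theorem theorem7p5:
  fixes D :: "('a,'b) pre_digraph"
  assumes "digraph D"
    and "semi_symmetric 3 D"
    and "\<And>e f. e \<in> lonely_arcs D \<Longrightarrow> f \<in> lonely_arcs D \<Longrightarrow> e \<noteq> f \<Longrightarrow>
           arc_endvertices D e \<inter> arc_endvertices D f = {}"
  shows "BE_diperfect D"
  unfolding BE_diperfect_def BE_property_def
proof (intro allI impI)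
  interpret digraph D by fact
  fix H S assume H: "induced_subgraph H D" and S: "maximum_stable_set H S"
  let ?E = "arcs_ends H"
  have sub: "verts H \<subseteq> verts D" "arcs H \<subseteq> arcs D" "wf_digraph H"
    and ends: "arc_to_ends H = arc_to_ends D"
    using H unfolding induced_subgraph_def subgraph_def compatible_def
    by (blast, blast, blast, simp add: arc_to_ends_def fun_eq_iff)
  have lonely: "?E - ?E\<inverse> = arc_to_ends D ` lonely_arcs H"
    using lonely_arcs_ends[of H] ends by simp
  have "finite (lonely_arcs D)" "card (lonely_arcs D) \<le> 3"
    using assms(2) by (auto simp: semi_symmetric_def)
  then have card: "card (?E - ?E\<inverse>) \<le> 3"
    unfolding lonely using lonely_arcs_induced[OF H]
    by (meson card_image_le card_mono finite_subset le_trans)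
  have "\<exists>P. begin_end_partition (verts H) ?E S P"
  proof (rule begin_end_lonely_matching[OF _ _ _ _ card])
    show "finite (verts H)" using sub(1) finite_verts by (rule finite_subset)
    show "?E \<subseteq> verts H \<times> verts H"
      using sub(3) by (auto simp: arcs_ends_conv wf_digraph.wellformed)
    show "(x, x) \<notin> ?E" for x
      using sub(2) no_loops unfolding arcs_ends_def ends arc_to_ends_def by auto
    show "max_indep (verts H) ?E S"
      using S unfolding maximum_stable_set_def max_indep_def stable_set_iff_indep by blast
    show "{x, y} \<inter> {u, v} = {}"
      if xy: "(x, y) \<in> ?E - ?E\<inverse>" and uv: "(u, v) \<in> ?E - ?E\<inverse>" and ne: "(x, y) \<noteq> (u, v)"
      for x y u v
    proof -
      obtain e f where "e \<in> lonely_arcs D" "f \<in> lonely_arcs D"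
        and ef: "(x, y) = arc_to_ends D e" "(u, v) = arc_to_ends D f"
        using xy uv lonely_arcs_induced[OF H] unfolding lonely by blast
      moreover from ef ne have "e \<noteq> f" by auto
      ultimately show ?thesis
        using assms(3)[of e f] unfolding arc_endvertices_def arc_to_ends_def by simp
    qed
  qed
  then show "\<exists>P. BE_path_partition H S P"
    by (simp add: BE_path_partition_iff)
qed

end
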